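(* Let $a,b>0$ be real numbers with $ab\neq 1$, and let $k\ge 1$ and $n\ge 0$ be integers. Then for every real $x$, $$B^{(k)}_n(x;a,b)=(\ln a+\ln b)\sum_{m=0}^{n}\binom{n}{m}B^{(k-1)}_{n-m}(a,b)\sum_{l=0}^{m}\frac{(-\ln a)^{m-l}}{n-l+1}\binom{m}{l}B_l(x;a^{-1},b).$$
   Context: For $k\in\mathbb{Z}$, ${\rm Li}_k(z)=\sum_{m=1}^{\infty} z^m/m^k$ (for $|z|<1$, or as a formal power series). For $a,b>0$ with $ab\ne 1$ and real $x$, the generalized poly-Bernoulli polynomials with parameters $a,b$, denoted $B^{(k)}_n(x;a,b)$, are defined by the power series expansion around $t=0$ $$\frac{{\rm Li}_k(1-(ab)^{-t})}{b^t-a^{-t}}\,e^{xt}=\sum_{n=0}^{\infty}B^{(k)}_n(x;a,b)\frac{t^n}{n!},$$ and $B^{(k)}_n(a,b):=B^{(k)}_n(0;a,b)$. For $\alpha,\beta>0$ with $\alpha\neq\beta$, the generalized Bernoulli polynomials $B_n(x;\alpha,\beta)$ (no superscript) are defined by the expansion around $t=0$ $$\frac{t}{\beta^t-\alpha^t}\,e^{xt}=\sum_{n=0}^{\infty}B_n(x;\alpha,\beta)\frac{t^n}{n!};$$ thus $B_l(x;a^{-1},b)$ has generating function $\frac{t}{b^t-a^{-t}}e^{xt}$. The singularities at $t=0$ are removable. Convention: $0^0=1$. *)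

theory Defs
  imports "HOL-Complex_Analysis.Complex_Analysis"
begin

text \<open>The index \<open>m\<close> is shifted by one, so the summation starts with \<open>z\<close>.\<close>

definition polylog :: "int \<Rightarrow> real \<Rightarrow> real" where
  "polylog k z = (\<Sum>m. z ^ Suc m / of_nat (Suc m) powi k)"

text \<open>
  The defining equations of the polynomials have the form \<open>f t = (\<Sum>n. c n * t ^ n / n!)\<close> for
  all \<open>t\<close> in a neighbourhood of \<open>0\<close>. All the functions \<open>f\<close> below have a removable
  singularity at \<open>0\<close>, where the HOL term only takes a junk value such as \<open>0 / 0 = 0\<close>;
  the equation is therefore required in a punctured neighbourhood.
\<close>

definition has_egf_expansion :: "(real \<Rightarrow> real) \<Rightarrow> (nat \<Rightarrow> real) \<Rightarrow> bool" where
  "has_egf_expansion f c \<longleftrightarrow> (\<forall>\<^sub>F t in at 0. (\<lambda>n. c n * (t ^ n / fact n)) sums f t)"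

definition egf_coeff :: "(real \<Rightarrow> real) \<Rightarrow> nat \<Rightarrow> real" where
  "egf_coeff f = (THE c. has_egf_expansion f c)"

lemma has_egf_expansion_unique:
  assumes "has_egf_expansion f c" and "has_egf_expansion f d"
  shows "c = d"
proof -
  define a where "a = (\<lambda>n. (c n - d n) / fact n)"
  have "\<forall>\<^sub>F t in at 0. (\<lambda>n. a n * t ^ n) sums 0"
    using assms unfolding has_egf_expansion_def
  proof eventually_elim
    case (elim t)
    from sums_diff[OF this] show ?case
      by (simp add: a_def algebra_simps diff_divide_distrib)
  qed
  then obtain r where "r > 0" and r: "\<And>t. t \<noteq> 0 \<Longrightarrow> norm t < r \<Longrightarrow> (\<lambda>n. a n * t ^ n) sums 0"
    by (auto simp: eventually_at dist_norm)
  have "((\<lambda>_. 0) \<longlongrightarrow> a 0) (at (0::real))"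
    using powser_limit_0_strong[of r a "\<lambda>_. 0"] \<open>r > 0\<close> r by blast
  then have a0: "a 0 = 0"
    by (metis LIM_const_eq)
  have r': "(\<lambda>n. a n * (t - 0) ^ n) sums 0" if "norm (t - 0) < r" for t
    using r[of t] that a0 powser_sums_zero[of a] by (cases "t = 0") auto
  have "a m = 0" for m
  proof (rule ccontr)
    assume "a m \<noteq> 0"
    with a0 have "m > 0" by (metis gr0I)
    obtain s where "s > 0" and "\<And>z. z \<in> cball 0 s - {0::real} \<Longrightarrow> (0::real) \<noteq> 0"
      using powser_0_nonzero[where f = "\<lambda>_. 0" and a = a and m = m and \<xi> = 0 and r = r]
        \<open>r > 0\<close> r' \<open>m > 0\<close> \<open>a m \<noteq> 0\<close> by blast
    from this(2)[of s] \<open>s > 0\<close> show False by (auto simp: dist_norm)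
  qed
  then show ?thesis
    by (auto simp: a_def fun_eq_iff)
qed

lemma egf_coeff_eqI: "has_egf_expansion f c \<Longrightarrow> egf_coeff f = c"
  unfolding egf_coeff_def using has_egf_expansion_unique by blast

definition poly_bernoulli :: "int \<Rightarrow> nat \<Rightarrow> real \<Rightarrow> real \<Rightarrow> real \<Rightarrow> real" where
  "poly_bernoulli k n x a b =
     egf_coeff (\<lambda>t. polylog k (1 - (a * b) powr (- t)) / (b powr t - a powr (- t)) * exp (x * t)) n"

definition poly_bernoulli_number :: "int \<Rightarrow> nat \<Rightarrow> real \<Rightarrow> real \<Rightarrow> real" where
  "poly_bernoulli_number k n a b = poly_bernoulli k n 0 a b"

definition gen_bernoulli :: "nat \<Rightarrow> real \<Rightarrow> real \<Rightarrow> real \<Rightarrow> real" where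
  "gen_bernoulli n x \<alpha> \<beta> =
     egf_coeff (\<lambda>t. t / (\<beta> powr t - \<alpha> powr t) * exp (x * t)) n"

text \<open>
  The expansions exist for all admissible parameters, so the descriptions above denote. To use
  the library's composition of expansions, the functions are extended to a complex
  neighbourhood of \<open>0\<close>.
\<close>

lemma has_egf_expansion_of_complex:
  fixes g :: "complex \<Rightarrow> complex"
  assumes g: "g has_fps_expansion F"
    and f: "\<forall>\<^sub>F t in at 0. g (of_real t) = of_real (f t)"
  shows "has_egf_expansion f (\<lambda>n. fact n * Re (fps_nth F n))"
proof -
  have "\<forall>\<^sub>F z in nhds (0::complex). z \<in> eball 0 (fps_conv_radius F)"
    using g by (intro eventually_nhds_in_open) (auto simp: has_fps_expansion_def zero_ereal_def)
  moreover have "\<forall>\<^sub>F z in nhds 0. eval_fps F z = g z"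
    using g by (simp add: has_fps_expansion_def)
  ultimately have "\<forall>\<^sub>F z in nhds (0::complex). (\<lambda>n. fps_nth F n * z ^ n) sums g z"
  proof eventually_elim
    case (elim z)
    then show ?case using sums_eval_fps[of z F] by auto
  qed
  moreover have "filterlim (of_real :: real \<Rightarrow> complex) (nhds 0) (at 0)"
    by (rule tendsto_eq_intros | simp)+
  ultimately have "\<forall>\<^sub>F t::real in at 0. (\<lambda>n. fps_nth F n * of_real t ^ n) sums g (of_real t)"
    by (rule eventually_compose_filterlim)
  with f show ?thesis
    unfolding has_egf_expansion_def
  proof eventually_elim
    case (elim t)
    from sums_Re[OF elim(2)] elim(1) show ?case by (simp flip: of_real_power)
  qed
qed

lemma has_egf_expansion_gen_bernoulli:
  assumes "\<alpha> > 0" "\<beta> > 0" "\<alpha> \<noteq> \<beta>"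
  shows "has_egf_expansion (\<lambda>t. t / (\<beta> powr t - \<alpha> powr t) * exp (x * t))
    (\<lambda>n. gen_bernoulli n x \<alpha> \<beta>)"
proof -
  define G :: "complex fps" where "G = fps_exp (of_real (ln \<beta>)) - fps_exp (of_real (ln \<alpha>))"
  have G: "fps_nth G 0 = 0" "fps_nth G 1 \<noteq> 0"
    using assms by (auto simp: G_def)
  then have sG: "subdegree G = 1" "G \<noteq> 0" by (auto intro: subdegreeI)
  define g where "g = (\<lambda>z::complex. (if z = 0 then fps_nth fps_X (subdegree G) / fps_nth G (subdegree G) else
      z / (exp (of_real (ln \<beta>) * z) - exp (of_real (ln \<alpha>) * z))) * exp (of_real x * z))"
  have "g has_fps_expansion (fps_X / G * fps_exp (of_real x))"
    unfolding g_def using sG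
    by (intro has_fps_expansion_mult has_fps_expansion_divide has_fps_expansion_fps_X has_fps_expansion_exp)
       (auto simp: G_def intro!: fps_expansion_intros)
  moreover have "\<forall>\<^sub>F t in at 0. g (of_real t) = of_real (t / (\<beta> powr t - \<alpha> powr t) * exp (x * t))"
    using eventually_neq_at_within[of 0 0]
    by eventually_elim (use assms in \<open>simp add: g_def powr_def exp_of_real mult_ac flip: of_real_mult\<close>)
  ultimately have *: "has_egf_expansion (\<lambda>t. t / (\<beta> powr t - \<alpha> powr t) * exp (x * t))
      (\<lambda>n. fact n * Re (fps_nth (fps_X / G * fps_exp (of_real x)) n))"
    by (rule has_egf_expansion_of_complex)
  then show ?thesis
    by (simp only: gen_bernoulli_def egf_coeff_eqI[OF *])
qed

lemma polylog_fps:
  defines "P k \<equiv> Abs_fps (\<lambda>m. if m = 0 then 0 else 1 / of_nat m powi k :: complex)"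
  shows "(\<lambda>z. eval_fps (P k) z) has_fps_expansion P k"
    and "\<bar>t\<bar> < 1 \<Longrightarrow> eval_fps (P k) (of_real t) = of_real (polylog k t)"
proof -
  have "(\<lambda>m. (real (Suc (Suc m)) / real (Suc m)) powi k) \<longlonglongrightarrow> 1 powi k"
    by (rule tendsto_power_int) (use LIMSEQ_Suc[OF LIMSEQ_Suc_n_over_n[where ?'a = real]] in \<open>simp_all del: of_nat_Suc\<close>)
  then have lim: "(\<lambda>m. norm (fps_nth (P k) (Suc m)) / norm (fps_nth (P k) (Suc (Suc m)))) \<longlonglongrightarrow> 1"
    by (simp add: P_def norm_divide norm_power_int power_int_divide_distrib del: of_nat_Suc)
  have "(\<lambda>m. norm (fps_nth (P k) m) / norm (fps_nth (P k) (Suc m))) \<longlonglongrightarrow> 1"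
    using LIMSEQ_imp_Suc[OF lim] .
  then have "(\<lambda>m. ereal (norm (fps_nth (P k) m) / norm (fps_nth (P k) (Suc m)))) \<longlonglongrightarrow> 1"
    by (simp add: one_ereal_def)
  have r: "fps_conv_radius (P k) = 1"
  proof -
    have ev: "\<forall>\<^sub>F m in sequentially. fps_nth (P k) m \<noteq> 0"
      using eventually_gt_at_top[of 0] by eventually_elim (auto simp: P_def)
    show ?thesis unfolding fps_conv_radius_def
      using conv_radius_ratio_limit_ereal[OF ev] \<open>(\<lambda>m. ereal (norm (fps_nth (P k) m) / norm (fps_nth (P k) (Suc m)))) \<longlonglongrightarrow> 1\<close> by blast
  qed
  then show "(\<lambda>z. eval_fps (P k) z) has_fps_expansion P k"
    by (auto simp: has_fps_expansion_def)
  assume t: "\<bar>t\<bar> < 1"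
  have "(\<lambda>n. fps_nth (P k) n * of_real t ^ n) sums eval_fps (P k) (of_real t)"
    using r t by (intro sums_eval_fps) (auto simp: one_ereal_def)
  then have "(\<lambda>n. fps_nth (P k) (Suc n) * of_real t ^ Suc n) sums eval_fps (P k) (of_real t)"
    by (subst sums_Suc_iff) (simp add: P_def)
  also have "(\<lambda>n. fps_nth (P k) (Suc n) * of_real t ^ Suc n) =
      (\<lambda>n. of_real (t ^ Suc n / of_nat (Suc n) powi k))"
    by (auto simp: P_def fun_eq_iff of_real_power_int simp del: of_nat_Suc)
  finally have s: "(\<lambda>n. complex_of_real (t ^ Suc n / of_nat (Suc n) powi k)) sums eval_fps (P k) (of_real t)" .
  from sums_Re[OF this] sums_Im[OF this] show "eval_fps (P k) (of_real t) = of_real (polylog k t)"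
    unfolding Re_complex_of_real Im_complex_of_real by (simp add: complex_eq_iff polylog_def sums_iff)
qed

lemma has_egf_expansion_poly_bernoulli:
  assumes "a > 0" "b > 0" "a * b \<noteq> 1"
  shows "has_egf_expansion
    (\<lambda>t. polylog k (1 - (a * b) powr (- t)) / (b powr t - a powr (- t)) * exp (x * t))
    (\<lambda>n. poly_bernoulli k n x a b)"
proof -
  define P :: "complex fps" where "P = Abs_fps (\<lambda>m. if m = 0 then 0 else 1 / of_nat m powi k)"
  define E :: "complex fps" where "E = 1 - fps_exp (of_real (- ln (a * b)))"
  define G :: "complex fps" where "G = fps_exp (of_real (ln b)) - fps_exp (of_real (- ln a))"
  have "ln (a * b) \<noteq> 0" using assms by simp
  then have "ln b \<noteq> - ln a" using assms by (simp add: ln_mult)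
  then have G: "fps_nth G 0 = 0" "fps_nth G 1 \<noteq> 0"
    by (simp_all add: G_def del: of_real_minus)
  then have sG: "subdegree G = 1" "G \<noteq> 0" by (auto intro: subdegreeI)
  have E0: "fps_nth E 0 = 0" by (simp add: E_def)
  have PE0: "fps_nth (P oo E) 0 = 0" by (simp add: P_def)
  have deg: "subdegree G \<le> subdegree (P oo E)" if "P oo E \<noteq> 0"
    using PE0 sG that by (simp add: Suc_leI subdegree_eq_0_iff flip: neq0_conv)
  have PE: "(eval_fps P \<circ> (\<lambda>z. 1 - exp (of_real (- ln (a * b)) * z))) has_fps_expansion (P oo E)"
    using polylog_fps(1)[of k] E0 unfolding P_def[symmetric] E_def
    by (intro has_fps_expansion_compose fps_expansion_intros) auto
  have "fps_nth (P oo E) 1 \<noteq> 0"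
    using \<open>ln (a * b) \<noteq> 0\<close> by (simp add: fps_compose_nth P_def E_def)
  then have PEnz: "P oo E \<noteq> 0" by auto
  define g where "g = (\<lambda>z::complex. (if z = 0 then fps_nth (P oo E) (subdegree G) / fps_nth G (subdegree G) else
      (eval_fps P \<circ> (\<lambda>z. 1 - exp (of_real (- ln (a * b)) * z))) z / (exp (of_real (ln b) * z) - exp (of_real (- ln a) * z))) * exp (of_real x * z))"
  have "g has_fps_expansion ((P oo E) / G * fps_exp (of_real x))"
    unfolding g_def using sG deg[OF PEnz]
    by (intro has_fps_expansion_mult has_fps_expansion_divide PE has_fps_expansion_exp)
       (auto simp only: G_def intro!: has_fps_expansion_diff has_fps_expansion_exp)
  moreover have "\<forall>\<^sub>F t in at 0. g (of_real t) =
    of_real (polylog k (1 - (a * b) powr (- t)) / (b powr t - a powr (- t)) * exp (x * t))"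
  proof -
    have "((\<lambda>t. 1 - exp (- ln (a * b) * t)) \<longlongrightarrow> 0) (at 0)"
      by (rule tendsto_eq_intros | simp)+
    then have "\<forall>\<^sub>F t in at 0. \<bar>1 - exp (- ln (a * b) * t)\<bar> < 1"
      using tendstoD[of "\<lambda>t. 1 - exp (- ln (a * b) * t)" 0 "at 0" 1] by (simp add: dist_norm)
    with eventually_neq_at_within[of 0 0] show ?thesis
    proof eventually_elim
      case (elim t)
      have "eval_fps P (1 - exp (of_real (- ln (a * b)) * of_real t)) =
          of_real (polylog k (1 - exp (- ln (a * b) * t)))"
        using polylog_fps(2)[OF elim(2), of k] unfolding P_def[symmetric]
        by (simp flip: exp_of_real)
      with elim(1) assms show ?case
        by (simp add: g_def powr_def mult_ac flip: exp_of_real)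
    qed
  qed
  ultimately have *: "has_egf_expansion
      (\<lambda>t. polylog k (1 - (a * b) powr (- t)) / (b powr t - a powr (- t)) * exp (x * t))
      (\<lambda>n. fact n * Re (fps_nth ((P oo E) / G * fps_exp (of_real x)) n))"
    by (rule has_egf_expansion_of_complex)
  then show ?thesis
    by (simp only: poly_bernoulli_def egf_coeff_eqI[OF *])
qed

end

theory Submission
  imports Defs
begin

text \<open>
  Write \<open>L = ln a + ln b\<close>, \<open>u = 1 - exp (- L t)\<close> and \<open>G = b\<^sup>t - a\<^sup>-\<^sup>t = b\<^sup>t u\<close>. Since \<open>z Li\<^sub>k'(z) = Li\<^sub>k\<^sub>-\<^sub>1(z)\<close>,
  the chain rule gives \<open>u (Li\<^sub>k(u))' = Li\<^sub>k\<^sub>-\<^sub>1(u) u'\<close>. If \<open>S\<close> generates the poly-Bernoulli numbers of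
  index \<open>k - 1\<close>, then \<open>Li\<^sub>k\<^sub>-\<^sub>1(u) = S G\<close>, and so \<open>(Li\<^sub>k(u))' = L exp (- t ln a) S\<close>. The series
  generating the poly-Bernoulli polynomials of index \<open>k\<close> is \<open>Li\<^sub>k(u) / t\<close>, with \<open>Li\<^sub>k(u)\<close> obtained by
  integrating this termwise, times the series generating the \<open>B\<^sub>l(x; 1/a, b)\<close>.
\<close>

section \<open>Expansions of real functions off the origin\<close>

text \<open>At \<open>0\<close> the quotients in question take junk values, so the library's
  expansion may fail for \<open>f\<close> itself. Agreement with an expandable \<open>g\<close> off
  \<open>0\<close> ignores that value, is stable under products and still determines
  \<open>F\<close>.\<close>

definition has_punctured_fps_expansion :: "(real \<Rightarrow> real) \<Rightarrow> real fps \<Rightarrow> bool" where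
  "has_punctured_fps_expansion f F \<longleftrightarrow> (\<exists>g. g has_fps_expansion F \<and> (\<forall>\<^sub>F t in at 0. g t = f t))"

definition egf_fps :: "(nat \<Rightarrow> real) \<Rightarrow> real fps" where
  "egf_fps c = Abs_fps (\<lambda>n. c n / fact n)"

lemma has_punctured_fps_expansionI:
  "f has_fps_expansion F \<Longrightarrow> has_punctured_fps_expansion f F"
  unfolding has_punctured_fps_expansion_def by (auto intro!: exI[of _ f])

lemma has_punctured_fps_expansion_cong:
  assumes "has_punctured_fps_expansion f F" "\<forall>\<^sub>F t in at 0. f t = g t"
  shows "has_punctured_fps_expansion g F"
proof -
  obtain h where h: "h has_fps_expansion F" "\<forall>\<^sub>F t in at 0. h t = f t"
    using assms(1) unfolding has_punctured_fps_expansion_def by blast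
  have "\<forall>\<^sub>F t in at 0. h t = g t"
    using h(2) assms(2) by eventually_elim simp
  with h show ?thesis unfolding has_punctured_fps_expansion_def by blast
qed

lemma has_punctured_fps_expansion_mult:
  assumes "has_punctured_fps_expansion f F" "has_punctured_fps_expansion g G"
  shows "has_punctured_fps_expansion (\<lambda>t. f t * g t) (F * G)"
proof -
  obtain h k where h: "h has_fps_expansion F" "\<forall>\<^sub>F t in at 0. h t = f t"
    and k: "k has_fps_expansion G" "\<forall>\<^sub>F t in at 0. k t = g t"
    using assms unfolding has_punctured_fps_expansion_def by blast
  have "(\<lambda>t. h t * k t) has_fps_expansion F * G"
    using h(1) k(1) by (rule has_fps_expansion_mult)
  moreover have "\<forall>\<^sub>F t in at 0. h t * k t = f t * g t"
    using h(2) k(2) by eventually_elim simp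
  ultimately show ?thesis unfolding has_punctured_fps_expansion_def by blast
qed

lemma has_egf_expansion_imp_punctured:
  assumes "has_egf_expansion f c"
  shows "has_punctured_fps_expansion f (egf_fps c)"
proof -
  have ev: "\<forall>\<^sub>F t in at 0. (\<lambda>n. fps_nth (egf_fps c) n * t ^ n) sums f t"
    using assms by (simp add: has_egf_expansion_def egf_fps_def)
  then obtain r where r: "r > 0"
    "\<And>t. t \<noteq> 0 \<Longrightarrow> norm t < r \<Longrightarrow> (\<lambda>n. fps_nth (egf_fps c) n * t ^ n) sums f t"
    by (auto simp: eventually_at dist_norm)
  \<comment> \<open>Convergence at the single point \<open>r / 2\<close> already makes the radius of
    convergence positive.\<close>
  have "ereal (r / 2) \<le> fps_conv_radius (egf_fps c)"
    using conv_radius_geI[of "fps_nth (egf_fps c)" "r / 2"] r(2)[of "r / 2"] r(1)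
    by (auto simp: fps_conv_radius_def sums_iff)
  then have "fps_conv_radius (egf_fps c) > 0"
    using r(1) by (metis ereal_less(2) half_gt_zero less_le_trans)
  then have "eval_fps (egf_fps c) has_fps_expansion egf_fps c"
    by (rule eval_fps_has_fps_expansion)
  moreover have "\<forall>\<^sub>F t in at 0. eval_fps (egf_fps c) t = f t"
    using ev by eventually_elim (simp add: eval_fps_def sums_iff)
  ultimately show ?thesis unfolding has_punctured_fps_expansion_def by blast
qed

lemma has_punctured_fps_expansion_imp_egf:
  assumes "has_punctured_fps_expansion f F"
  shows "has_egf_expansion f (\<lambda>n. fact n * fps_nth F n)"
proof -
  obtain g where g: "g has_fps_expansion F" "\<forall>\<^sub>F t in at 0. g t = f t"
    using assms unfolding has_punctured_fps_expansion_def by blast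
  have "\<forall>\<^sub>F t in nhds 0. t \<in> eball 0 (fps_conv_radius F)"
    using g(1) by (intro eventually_nhds_in_open) (auto simp: has_fps_expansion_def zero_ereal_def)
  then have "\<forall>\<^sub>F t in at 0. t \<in> eball 0 (fps_conv_radius F)"
    by (auto simp: eventually_at_filter elim: eventually_mono)
  moreover have "\<forall>\<^sub>F t in at 0. eval_fps F t = g t"
    using g(1) by (auto simp: has_fps_expansion_def eventually_at_filter elim: eventually_mono)
  ultimately show ?thesis
    unfolding has_egf_expansion_def using g(2)
  proof eventually_elim
    case (elim t)
    then show ?case using sums_eval_fps[of t F] by auto
  qed
qed

lemma has_punctured_fps_expansion_unique:
  assumes "has_punctured_fps_expansion f F" "has_punctured_fps_expansion f G"
  shows "F = G"
  using has_egf_expansion_unique[OF assms[THEN has_punctured_fps_expansion_imp_egf]]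
  by (simp add: fps_eq_iff fun_eq_iff)

section \<open>The series of the polylogarithm\<close>

text \<open>Powers of a series with real coefficients have real coefficients. This carries a
  composition formed over the complex numbers back to the reals.\<close>

lemma fps_compose_of_real:
  fixes F G :: "real fps"
  shows "Abs_fps (\<lambda>n. complex_of_real (fps_nth F n)) oo Abs_fps (\<lambda>n. complex_of_real (fps_nth G n)) =
    Abs_fps (\<lambda>n. complex_of_real (fps_nth (F oo G) n))"
proof -
  have "fps_nth (Abs_fps (\<lambda>n. complex_of_real (fps_nth G n)) ^ i) n = of_real (fps_nth (G ^ i) n)" for i n
    by (induction i arbitrary: n) (simp_all add: fps_mult_nth)
  then show ?thesis by (simp add: fps_eq_iff fps_compose_nth)
qed

text \<open>The case \<open>m = 0\<close> matters for \<open>k = 0\<close>: there the general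
  formula would give the constant term \<open>1\<close>.\<close>

definition polylog_fps :: "int \<Rightarrow> real fps" where
  "polylog_fps k = Abs_fps (\<lambda>m. if m = 0 then 0 else 1 / of_nat m powi k)"

text \<open>Multiplying the coefficient \<open>1 / m powi k\<close> by \<open>m\<close> lowers the
  exponent by one.\<close>

lemma fps_X_mult_deriv_polylog_fps: "fps_X * fps_deriv (polylog_fps k) = polylog_fps (k - 1)"
  by (auto simp: fps_eq_iff polylog_fps_def power_int_diff gr0_conv_Suc simp del: of_nat_Suc)

text \<open>The composition is expanded over the complex numbers, where \<open>eval_fps P\<close>
  extends \<open>polylog k\<close>; its coefficients are real, so taking real parts loses
  nothing.\<close>

lemma has_punctured_fps_expansion_polylog_exp:
  "has_punctured_fps_expansion (\<lambda>t. polylog k (1 - exp (- c * t))) (polylog_fps k oo (1 - fps_exp (- c)))"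
proof -
  define P :: "complex fps" where "P = Abs_fps (\<lambda>m. if m = 0 then 0 else 1 / of_nat m powi k)"
  define E :: "complex fps" where "E = 1 - fps_exp (of_real (- c))"
  have P: "P = Abs_fps (\<lambda>n. of_real (fps_nth (polylog_fps k) n))"
    by (simp add: P_def polylog_fps_def fps_eq_iff of_real_power_int)
  have E: "E = Abs_fps (\<lambda>n. of_real (fps_nth (1 - fps_exp (- c)) n))"
    by (simp add: E_def fps_eq_iff)
  have "(eval_fps P \<circ> (\<lambda>z. 1 - exp (of_real (- c) * z))) has_fps_expansion (P oo E)"
    using polylog_fps(1)[of k] unfolding P_def[symmetric] E_def
    by (intro has_fps_expansion_compose fps_expansion_intros) auto
  moreover have "\<forall>\<^sub>F t in at 0. (eval_fps P \<circ> (\<lambda>z. 1 - exp (of_real (- c) * z))) (of_real t) =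
      of_real (polylog k (1 - exp (- c * t)))"
  proof -
    have "((\<lambda>t. 1 - exp (- c * t)) \<longlongrightarrow> 0) (at 0)"
      by (rule tendsto_eq_intros | simp)+
    \<comment> \<open>Near \<open>0\<close> the argument stays inside the unit disc, where the
      series represents \<open>polylog k\<close>.\<close>
    then have "\<forall>\<^sub>F t in at 0. \<bar>1 - exp (- c * t)\<bar> < 1"
      using tendstoD[of "\<lambda>t. 1 - exp (- c * t)" 0 "at 0" 1] by (simp add: dist_norm)
    then show ?thesis
    proof eventually_elim
      case (elim t)
      show ?case
        using polylog_fps(2)[OF elim, of k] unfolding P_def[symmetric]
        by (simp flip: exp_of_real)
    qed
  qed
  ultimately have "has_egf_expansion (\<lambda>t. polylog k (1 - exp (- c * t)))
      (\<lambda>n. fact n * Re (fps_nth (P oo E) n))"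
    by (rule has_egf_expansion_of_complex)
  then have "has_punctured_fps_expansion (\<lambda>t. polylog k (1 - exp (- c * t)))
      (egf_fps (\<lambda>n. fact n * Re (fps_nth (P oo E) n)))"
    by (rule has_egf_expansion_imp_punctured)
  also have "egf_fps (\<lambda>n. fact n * Re (fps_nth (P oo E) n)) = polylog_fps k oo (1 - fps_exp (- c))"
    unfolding P E fps_compose_of_real by (simp add: egf_fps_def fps_eq_iff)
  finally show ?thesis .
qed

section \<open>Identities between the generating functions\<close>

text \<open>In each identity both sides expand the same function, and uniqueness equates the series.
  The denominator is moved to the left as the factor \<open>G\<close>, so no division of series
  occurs; it cancels off \<open>0\<close> because \<open>b powr t = a powr (- t)\<close> forces
  \<open>L * t = 0\<close>, where \<open>L\<close> is nonzero.\<close>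

lemma
  fixes a b x :: real
  assumes "a > 0" "b > 0" "a * b \<noteq> 1"
  defines "L \<equiv> ln a + ln b" and "G \<equiv> fps_exp (ln b) - fps_exp (- ln a)"
  shows egf_fps_poly_bernoulli:
      "egf_fps (\<lambda>n. poly_bernoulli k n x a b) * G =
         (polylog_fps k oo (1 - fps_exp (- L))) * fps_exp x"
    and egf_fps_gen_bernoulli:
      "egf_fps (\<lambda>n. gen_bernoulli n x (inverse a) b) * G = fps_X * fps_exp x"
proof -
  have "ln (a * b) \<noteq> 0" using assms by simp
  then have L: "L \<noteq> 0" "ln (a * b) = L" using assms by (simp_all add: ln_mult L_def)
  have ab: "inverse a > 0" "inverse a \<noteq> b" using assms by auto
  have G: "has_punctured_fps_expansion (\<lambda>t. exp (ln b * t) - exp (- ln a * t)) G"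
    unfolding G_def by (intro has_punctured_fps_expansionI fps_expansion_intros)
  have X: "has_punctured_fps_expansion (\<lambda>t. exp (x * t)) (fps_exp x)"
    by (intro has_punctured_fps_expansionI fps_expansion_intros)
  have nz: "exp (ln b * t) - exp (- ln a * t) \<noteq> 0" if "t \<noteq> 0" for t
  proof
    assume "exp (ln b * t) - exp (- ln a * t) = 0"
    then have "L * t = 0" by (simp add: L_def algebra_simps)
    with L that show False by simp
  qed
  note ev = eventually_neq_at_within[of "0::real" 0 UNIV]
  show "egf_fps (\<lambda>n. poly_bernoulli k n x a b) * G =
         (polylog_fps k oo (1 - fps_exp (- L))) * fps_exp x"
  proof (rule has_punctured_fps_expansion_unique)
    show "has_punctured_fps_expansion (\<lambda>t. polylog k (1 - exp (- L * t)) * exp (x * t))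
        ((polylog_fps k oo (1 - fps_exp (- L))) * fps_exp x)"
      by (intro has_punctured_fps_expansion_mult has_punctured_fps_expansion_polylog_exp X)
    show "has_punctured_fps_expansion (\<lambda>t. polylog k (1 - exp (- L * t)) * exp (x * t))
        (egf_fps (\<lambda>n. poly_bernoulli k n x a b) * G)"
    proof (rule has_punctured_fps_expansion_cong[OF has_punctured_fps_expansion_mult])
      show "has_punctured_fps_expansion
          (\<lambda>t. polylog k (1 - (a * b) powr (- t)) / (b powr t - a powr (- t)) * exp (x * t))
          (egf_fps (\<lambda>n. poly_bernoulli k n x a b))"
        using assms by (intro has_egf_expansion_imp_punctured has_egf_expansion_poly_bernoulli)
      show "\<forall>\<^sub>F t in at 0. polylog k (1 - (a * b) powr (- t)) / (b powr t - a powr (- t)) * exp (x * t) *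
          (exp (ln b * t) - exp (- ln a * t)) = polylog k (1 - exp (- L * t)) * exp (x * t)"
        using ev
      proof eventually_elim
        case (elim t)
        then show ?case using nz[of t] assms(1-3) L(2) by (simp add: powr_def mult_ac)
      qed
    qed (rule G)
  qed
  show "egf_fps (\<lambda>n. gen_bernoulli n x (inverse a) b) * G = fps_X * fps_exp x"
  proof (rule has_punctured_fps_expansion_unique)
    show "has_punctured_fps_expansion (\<lambda>t. t * exp (x * t)) (fps_X * fps_exp x)"
      by (intro has_punctured_fps_expansionI fps_expansion_intros)
    show "has_punctured_fps_expansion (\<lambda>t. t * exp (x * t))
        (egf_fps (\<lambda>n. gen_bernoulli n x (inverse a) b) * G)"
    proof (rule has_punctured_fps_expansion_cong[OF has_punctured_fps_expansion_mult])
      show "has_punctured_fps_expansion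
          (\<lambda>t. t / (b powr t - inverse a powr t) * exp (x * t))
          (egf_fps (\<lambda>n. gen_bernoulli n x (inverse a) b))"
        using assms ab by (intro has_egf_expansion_imp_punctured has_egf_expansion_gen_bernoulli)
      show "\<forall>\<^sub>F t in at 0. t / (b powr t - inverse a powr t) * exp (x * t) *
          (exp (ln b * t) - exp (- ln a * t)) = t * exp (x * t)"
        using ev
      proof eventually_elim
        case (elim t)
        then show ?case using nz[of t] assms(1-3) by (simp add: powr_def ln_inverse mult_ac)
      qed
    qed (rule G)
  qed
qed

text \<open>With \<open>E\<close> the series of u, both \<open>S * fps_exp (ln b)\<close> and
  \<open>fps_deriv (polylog_fps k) oo E\<close> become \<open>polylog_fps (k - 1) oo E\<close> after
  multiplication by \<open>E\<close>. Since \<open>E\<close> is nonzero they agree, and the chain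
  rule supplies the remaining factor.\<close>

lemma fps_deriv_polylog_exp:
  fixes a b :: real
  assumes "a > 0" "b > 0" "a * b \<noteq> 1"
  defines "L \<equiv> ln a + ln b"
  shows "fps_deriv (polylog_fps k oo (1 - fps_exp (- L))) =
    fps_const L * (fps_exp (- ln a) * egf_fps (\<lambda>n. poly_bernoulli_number (k - 1) n a b))"
proof -
  define E :: "real fps" where "E = 1 - fps_exp (- L)"
  define S where "S = egf_fps (\<lambda>n. poly_bernoulli_number (k - 1) n a b)"
  have "ln (a * b) \<noteq> 0" using assms by simp
  then have "L \<noteq> 0" using assms by (simp add: ln_mult)
  then have "fps_nth E 1 \<noteq> 0" by (simp add: E_def)
  then have "E \<noteq> 0" by auto
  have E0: "fps_nth E 0 = 0" by (simp add: E_def)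
  have E': "fps_deriv E = fps_const L * fps_exp (- L)"
    by (simp add: E_def flip: fps_const_neg)
  have "ln b + - L = - ln a" by (simp add: L_def)
  then have mult_exp: "fps_exp (ln b) * fps_exp (- L) = fps_exp (- ln a)"
    using fps_exp_add_mult[of "ln b" "- L"] by simp
  then have G: "fps_exp (ln b) - fps_exp (- ln a) = fps_exp (ln b) * E"
    by (simp add: E_def algebra_simps)
  \<comment> \<open>The numbers are the values at \<open>x = 0\<close>, where the factor
    \<open>fps_exp x\<close> is \<open>1\<close>.\<close>
  have "S * (fps_exp (ln b) * E) = polylog_fps (k - 1) oo E"
    using egf_fps_poly_bernoulli[OF assms(1-3), of "k - 1" 0] G
    unfolding S_def E_def L_def poly_bernoulli_number_def by simp
  also have "\<dots> = E * (fps_deriv (polylog_fps k) oo E)"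
    using E0 by (simp add: fps_compose_mult_distrib flip: fps_X_mult_deriv_polylog_fps)
  finally have "fps_deriv (polylog_fps k) oo E = S * fps_exp (ln b)"
    using \<open>E \<noteq> 0\<close> by (metis mult.assoc mult.commute mult_left_cancel)
  then have "fps_deriv (polylog_fps k oo E) = S * fps_exp (ln b) * (fps_const L * fps_exp (- L))"
    using E0 E' by (simp add: fps_compose_deriv)
  also have "\<dots> = fps_const L * (fps_exp (ln b) * fps_exp (- L) * S)"
    by (simp only: mult_ac)
  finally show ?thesis
    unfolding E_def S_def mult_exp .
qed

text \<open>Multiplied by \<open>G\<close>, both sides equal the polylogarithm series times
  \<open>fps_X * fps_exp x\<close>. The linear coefficient of \<open>G\<close> is
  \<open>ln a + ln b\<close>, which is nonzero, so \<open>G\<close> cancels.\<close>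

lemma poly_bernoulli_egf_eq:
  fixes a b x :: real
  assumes "a > 0" "b > 0" "a * b \<noteq> 1"
  defines "L \<equiv> ln a + ln b"
  shows "fps_X * egf_fps (\<lambda>n. poly_bernoulli k n x a b) =
    (polylog_fps k oo (1 - fps_exp (- L))) * egf_fps (\<lambda>n. gen_bernoulli n x (inverse a) b)"
proof -
  define G where "G = fps_exp (ln b) - fps_exp (- ln a)"
  have "ln (a * b) \<noteq> 0" using assms by simp
  then have "fps_nth G 1 \<noteq> 0" using assms by (simp add: G_def ln_mult)
  then have "G \<noteq> 0" by auto
  have "fps_X * egf_fps (\<lambda>n. poly_bernoulli k n x a b) * G =
      (polylog_fps k oo (1 - fps_exp (- L))) * (fps_X * fps_exp x)"
    using egf_fps_poly_bernoulli[OF assms(1-3), of k x] by (simp add: G_def L_def mult_ac)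
  also have "\<dots> = (polylog_fps k oo (1 - fps_exp (- L))) *
      egf_fps (\<lambda>n. gen_bernoulli n x (inverse a) b) * G"
    using egf_fps_gen_bernoulli[OF assms(1-3), of x] by (simp add: G_def mult_ac)
  finally show ?thesis using \<open>G \<noteq> 0\<close> by simp
qed

section \<open>Comparison of coefficients\<close>

text \<open>Both sums run over the pairs with \<open>l + i \<le> n\<close>, where
  \<open>m = l + i\<close>.\<close>

lemma sum_triangle_swap:
  fixes g :: "nat \<Rightarrow> nat \<Rightarrow> 'a :: comm_monoid_add"
  shows "(\<Sum>m\<le>n. \<Sum>l\<le>m. g l (m - l)) = (\<Sum>l\<le>n. \<Sum>i\<le>n - l. g l i)"
proof -
  have "(\<Sum>l\<le>n. \<Sum>i\<le>n - l. g l i) = (\<Sum>(l, i)\<in>(SIGMA l:{..n}. {..n - l}). g l i)"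
    by (simp add: sum.Sigma)
  also have "(SIGMA l:{..n}. {..n - l}) = {(l, i). l + i \<le> n}" by auto
  finally show ?thesis by (simp add: sum.triangle_reindex_eq)
qed

theorem theorem2p5:
  fixes a b x :: real and k :: int and n :: nat
  assumes "a > 0" and "b > 0" and "a * b \<noteq> 1" and "k \<ge> 1"
  shows "poly_bernoulli k n x a b =
    (ln a + ln b) *
      (\<Sum>m=0..n. real (n choose m) * poly_bernoulli_number (k - 1) (n - m) a b *
        (\<Sum>l=0..m. (- ln a) ^ (m - l) / (real n - real l + 1) * real (m choose l) *
          gen_bernoulli l x (inverse a) b))"
proof -
  define L where "L = ln a + ln b"
  define S where "S = (\<lambda>n. poly_bernoulli_number (k - 1) n a b)"
  define B where "B = (\<lambda>l. gen_bernoulli l x (inverse a) b)"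
  define Q where "Q = polylog_fps k oo (1 - fps_exp (- L))"
  \<comment> \<open>The factors are, in turn, the coefficients of \<open>fps_exp (- ln a)\<close>
    and of the series of \<open>S\<close>, the divisor from termwise integration, and the
    coefficient of the series of \<open>B\<close>. The constant \<open>L\<close> is kept
    outside.\<close>
  define h where "h = (\<lambda>l i. fact n * ((- ln a) ^ i / fact i * (S (n - l - i) / fact (n - l - i)) /
    (real (n - l) + 1) * (B l / fact l)))"
  have Q0: "fps_nth Q 0 = 0" by (simp add: Q_def polylog_fps_def)
  \<comment> \<open>Termwise integration of the formula for \<open>fps_deriv Q\<close>.\<close>
  have Q: "fps_nth Q (Suc j) = L * (\<Sum>i\<le>j. (- ln a) ^ i / fact i * (S (j - i) / fact (j - i))) / (real j + 1)" for j
  proof -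
    have "(real j + 1) * fps_nth Q (Suc j) = fps_nth (fps_deriv Q) j" by simp
    also have "\<dots> = L * (\<Sum>i\<le>j. (- ln a) ^ i / fact i * (S (j - i) / fact (j - i)))"
      unfolding Q_def L_def fps_deriv_polylog_exp[OF assms(1-3)]
      by (simp add: fps_mult_nth[of "fps_exp (- ln a)"] egf_fps_def S_def atLeast0AtMost)
    finally show ?thesis by (simp add: field_simps)
  qed
  \<comment> \<open>The factor \<open>fps_X\<close> shifts the index, so the coefficients at
    \<open>Suc n\<close> are compared.\<close>
  have "poly_bernoulli k n x a b / fact n =
      fps_nth (fps_X * egf_fps (\<lambda>n. poly_bernoulli k n x a b)) (Suc n)"
    by (simp add: egf_fps_def)
  also have "\<dots> = fps_nth (egf_fps B * Q) (Suc n)"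
    unfolding poly_bernoulli_egf_eq[OF assms(1-3)] by (simp add: Q_def L_def B_def mult.commute)
  \<comment> \<open>The term \<open>l = Suc n\<close> of the product drops out because
    \<open>Q\<close> has constant term \<open>0\<close>.\<close>
  also have "\<dots> = (\<Sum>l\<le>n. B l / fact l * fps_nth Q (Suc n - l))"
    using Q0 by (simp add: fps_mult_nth egf_fps_def atLeast0AtMost)
  also have "\<dots> = (\<Sum>l\<le>n. B l / fact l * fps_nth Q (Suc (n - l)))"
    by (intro sum.cong) (auto simp: Suc_diff_le)
  finally have "poly_bernoulli k n x a b = fact n * (\<Sum>l\<le>n. B l / fact l * fps_nth Q (Suc (n - l)))"
    by (simp add: field_simps)
  also have "\<dots> = L * (\<Sum>l\<le>n. \<Sum>i\<le>n - l. h l i)"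
    unfolding Q h_def by (simp add: sum_distrib_left sum_distrib_right sum_divide_distrib mult_ac)
  also have "(\<Sum>l\<le>n. \<Sum>i\<le>n - l. h l i) = (\<Sum>m\<le>n. \<Sum>l\<le>m. h l (m - l))"
    by (rule sum_triangle_swap[symmetric])
  \<comment> \<open>With \<open>i = m - l\<close> the index \<open>n - l - i\<close> is
    \<open>n - m\<close>, and the factorials combine to
    \<open>(n choose m) * (m choose l)\<close>.\<close>
  also have "\<dots> = (\<Sum>m\<le>n. \<Sum>l\<le>m. real (n choose m) * S (n - m) *
      ((- ln a) ^ (m - l) / (real n - real l + 1) * real (m choose l) * B l))"
  proof (intro sum.cong refl)
    fix m l assume "m \<in> {..n}" "l \<in> {..m}"
    then show "h l (m - l) = real (n choose m) * S (n - m) *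
      ((- ln a) ^ (m - l) / (real n - real l + 1) * real (m choose l) * B l)"
      by (simp add: h_def binomial_fact of_nat_diff field_simps)
  qed
  finally show ?thesis
    by (simp add: L_def S_def B_def sum_distrib_left atLeast0AtMost)
qed

end
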